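(* There is an algorithm that solves the Jury Selection Problem under the Altruism Jurors Model (AltrM) exactly in $O(N^2 \log N)$ time: given a candidate juror set $S$ with $|S| = N$ and individual error rates $\epsilon_1,\dots,\epsilon_N \in (0,1)$, it outputs a jury $J \subseteq S$ of odd size such that $JER(J) \le JER(J')$ for every jury $J' \subseteq S$ of odd size.
   Context: A jury is a subset $J$ of $S$ of odd size $n$, $1 \le n \le N$. Individual error rate $\epsilon_i$ is the probability that juror $j_i$ votes wrongly; jurors err independently. The jury error rate under majority voting is the probability that at least $\frac{n+1}{2}$ of the jurors in $J$ vote wrongly: $$JER(J) = \sum_{k=\frac{n+1}{2}}^{n} \ \sum_{A \subseteq J,\ |A| = k} \ \prod_{j_i \in A} \epsilon_i \prod_{j_i \in J\setminus A} (1-\epsilon_i).$$ In the Altruism Jurors Model every possible jury is allowed (there is no budget constraint), and the Jury Selection Problem asks for an allowed jury minimizing $JER$. Cost model: each arithmetic operation or comparison on real numbers takes $O(1)$ time. *)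

theory Defs
  imports Complex_Main "HOL-Library.Landau_Symbols"
begin

section \<open>Juries and the jury error rate\<close>

definition jury :: "'a set \<Rightarrow> 'a set \<Rightarrow> bool" where
  "jury S J \<longleftrightarrow> J \<subseteq> S \<and> odd (card J)"

definition JER :: "('a \<Rightarrow> real) \<Rightarrow> 'a set \<Rightarrow> real" where
  "JER \<epsilon> J = (\<Sum>k = (card J + 1) div 2..card J. \<Sum>A | A \<subseteq> J \<and> card A = k.
      (\<Prod>j\<in>A. \<epsilon> j) * (\<Prod>j\<in>J - A. 1 - \<epsilon> j))"

definition AltrM :: "'a set \<Rightarrow> 'a set set" where
  "AltrM S = {J. jury S J}"

definition solves_JSP :: "('a \<Rightarrow> real) \<Rightarrow> 'a set set \<Rightarrow> 'a set \<Rightarrow> bool" where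
  "solves_JSP \<epsilon> allowed J \<longleftrightarrow> J \<in> allowed \<and> (\<forall>J'\<in>allowed. JER \<epsilon> J \<le> JER \<epsilon> J')"


section \<open>A real RAM with unit costs\<close>

text \<open>
  Algorithms are finite programs over registers and arrays that hold either natural numbers
  (used as indices) or exact real numbers. The two sorts are kept apart: there is no rounding
  and no conversion between them, and the only real constants are integers, so that no
  information can be hidden in a program constant. Every instruction and every evaluation of
  a test costs one unit. Index arithmetic is restricted to successor and predecessor:
  within \<open>t\<close> steps no index exceeds the largest initial index or program constant by
  more than \<open>t\<close>, hence unit cost for indices cannot be abused.
\<close>

type_synonym name = string

record state =
  nreg :: "name \<Rightarrow> nat"
  narr :: "name \<Rightarrow> nat \<Rightarrow> nat"
  rreg :: "name \<Rightarrow> real"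
  rarr :: "name \<Rightarrow> nat \<Rightarrow> real"

datatype instr =
    NConst name nat
  | NMove name name
  | NSucc name name
  | NPred name name
  | NLoad name name name   \<comment> \<open>\<open>NLoad x a i\<close> is \<open>x := a[i]\<close>\<close>
  | NStore name name name  \<comment> \<open>\<open>NStore a i x\<close> is \<open>a[i] := x\<close>\<close>
  | RConst name int
  | RMove name name
  | RAdd name name name    \<comment> \<open>\<open>RAdd x y z\<close> is \<open>x := y + z\<close>\<close>
  | RSub name name name
  | RMult name name name
  | RDiv name name name
  | RLoad name name name
  | RStore name name name

datatype test =
    NLess name name
  | NEq name name
  | RLess name name
  | REq name name

datatype com =
    Do instr
  | Seq com com
  | Cond test com com
  | While test com

fun step :: "instr \<Rightarrow> state \<Rightarrow> state" where
  "step (NConst x c) s = s\<lparr>nreg := (nreg s)(x := c)\<rparr>"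
| "step (NMove x y) s = s\<lparr>nreg := (nreg s)(x := nreg s y)\<rparr>"
| "step (NSucc x y) s = s\<lparr>nreg := (nreg s)(x := nreg s y + 1)\<rparr>"
| "step (NPred x y) s = s\<lparr>nreg := (nreg s)(x := nreg s y - 1)\<rparr>"
| "step (NLoad x a i) s = s\<lparr>nreg := (nreg s)(x := narr s a (nreg s i))\<rparr>"
| "step (NStore a i x) s = s\<lparr>narr := (narr s)(a := (narr s a)(nreg s i := nreg s x))\<rparr>"
| "step (RConst x c) s = s\<lparr>rreg := (rreg s)(x := of_int c)\<rparr>"
| "step (RMove x y) s = s\<lparr>rreg := (rreg s)(x := rreg s y)\<rparr>"
| "step (RAdd x y z) s = s\<lparr>rreg := (rreg s)(x := rreg s y + rreg s z)\<rparr>"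
| "step (RSub x y z) s = s\<lparr>rreg := (rreg s)(x := rreg s y - rreg s z)\<rparr>"
| "step (RMult x y z) s = s\<lparr>rreg := (rreg s)(x := rreg s y * rreg s z)\<rparr>"
| "step (RDiv x y z) s = s\<lparr>rreg := (rreg s)(x := rreg s y / rreg s z)\<rparr>"
| "step (RLoad x a i) s = s\<lparr>rreg := (rreg s)(x := rarr s a (nreg s i))\<rparr>"
| "step (RStore a i x) s = s\<lparr>rarr := (rarr s)(a := (rarr s a)(nreg s i := rreg s x))\<rparr>"

fun holds :: "test \<Rightarrow> state \<Rightarrow> bool" where
  "holds (NLess x y) s \<longleftrightarrow> nreg s x < nreg s y"
| "holds (NEq x y) s \<longleftrightarrow> nreg s x = nreg s y"
| "holds (RLess x y) s \<longleftrightarrow> rreg s x < rreg s y"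
| "holds (REq x y) s \<longleftrightarrow> rreg s x = rreg s y"

text \<open>
  \<open>run P s t s'\<close>: started in \<open>s\<close>, the program \<open>P\<close> halts in \<open>s'\<close> after exactly
  \<open>t\<close> units of time.
\<close>

inductive run :: "com \<Rightarrow> state \<Rightarrow> nat \<Rightarrow> state \<Rightarrow> bool" where
  run_Do: "run (Do c) s 1 (step c s)"
| run_Seq: "run P s t s' \<Longrightarrow> run Q s' u s'' \<Longrightarrow> run (Seq P Q) s (t + u) s''"
| run_Cond_True: "holds b s \<Longrightarrow> run P s t s' \<Longrightarrow> run (Cond b P Q) s (t + 1) s'"
| run_Cond_False: "\<not> holds b s \<Longrightarrow> run Q s t s' \<Longrightarrow> run (Cond b P Q) s (t + 1) s'"
| run_While_False: "\<not> holds b s \<Longrightarrow> run (While b P) s 1 s"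
| run_While_True:
    "holds b s \<Longrightarrow> run P s t s' \<Longrightarrow> run (While b P) s' u s'' \<Longrightarrow>
     run (While b P) s (t + u + 1) s''"

inductive_cases run_DoE: "run (Do c) s t s'"
inductive_cases run_SeqE: "run (Seq P Q) s t s'"
inductive_cases run_CondE: "run (Cond b P Q) s t s'"
inductive_cases run_WhileE: "run (While b P) s t s'"

lemma run_deterministic:
  "run P s t s' \<Longrightarrow> run P s u s'' \<Longrightarrow> u = t \<and> s'' = s'"
proof (induction arbitrary: u s'' rule: run.induct)
  case (run_Do c s)
  then show ?case by (auto elim: run_DoE)
next
  case (run_Seq P s t s1 Q v s2)
  from run_Seq.prems obtain t' s1' v' where
    "run P s t' s1'" "run Q s1' v' s''" "u = t' + v'" by (auto elim: run_SeqE)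
  with run_Seq.IH(1)[of t' s1'] run_Seq.IH(2)[of v' s''] show ?case by simp
next
  case (run_Cond_True b s P t s1 Q)
  from run_Cond_True.prems run_Cond_True.hyps(1) obtain t' where
    "run P s t' s''" "u = t' + 1" by (auto elim: run_CondE)
  with run_Cond_True.IH[of t' s''] show ?case by simp
next
  case (run_Cond_False b s Q t s1 P)
  from run_Cond_False.prems run_Cond_False.hyps(1) obtain t' where
    "run Q s t' s''" "u = t' + 1" by (auto elim: run_CondE)
  with run_Cond_False.IH[of t' s''] show ?case by simp
next
  case (run_While_False b s P)
  from run_While_False.prems run_While_False.hyps show ?case by (auto elim: run_WhileE)
next
  case (run_While_True b s P t s1 v s2)
  from run_While_True.prems run_While_True.hyps(1) obtain t' s1' v' where
    "run P s t' s1'" "run (While b P) s1' v' s''" "u = t' + v' + 1"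
    by (auto elim: run_WhileE)
  with run_While_True.IH(1)[of t' s1'] run_While_True.IH(2)[of v' s''] show ?case by simp
qed


section \<open>Input and output convention\<close>

text \<open>
  The candidate jurors are identified with \<open>1, \<dots>, N\<close>. Initially register \<open>N\<close> holds the
  number of candidates, array \<open>eps\<close> the error rates, and everything else is zero. The computed
  jury is the set whose characteristic vector is found in the array \<open>jury\<close>.
\<close>

definition input_state :: "nat \<Rightarrow> (nat \<Rightarrow> real) \<Rightarrow> state" where
  "input_state N \<epsilon> =
    \<lparr>nreg = (\<lambda>_. 0)(''N'' := N),
     narr = (\<lambda>_ _. 0),
     rreg = (\<lambda>_. 0),
     rarr = (\<lambda>_ _. 0)(''eps'' := (\<lambda>i. if i \<in> {1..N} then \<epsilon> i else 0))\<rparr>"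

definition output_jury :: "nat \<Rightarrow> state \<Rightarrow> nat set" where
  "output_jury N s = {i \<in> {1..N}. narr s ''jury'' i = 1}"

end

theory Submission
  imports Defs
begin

text \<open>
  The probability that at least \<open>k\<close> jurors of \<open>J\<close> err is increasing in each individual error rate,
  so among the juries of a fixed size one consisting of the jurors with the smallest error rates is
  optimal, and only \<open>N\<close> nested juries have to be compared. They are built by repeatedly selecting a
  juror with minimal error rate among those left. Adding a juror with error rate \<open>e\<close> turns the tail
  probabilities \<open>q k\<close> into \<open>e * q (k - 1) + (1 - e) * q k\<close>, and for odd size \<open>m\<close> the error rate of the
  jury is \<open>q ((m + 1) div 2)\<close>. Both the selection and the update take linear time per juror, which
  gives quadratic time altogether, even without a faster sorting algorithm.
\<close>

section \<open>Tail probabilities of the number of wrong votes\<close>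

text \<open>Unlike in \<open>JER\<close>, the threshold \<open>k\<close> does not depend on the size
  of \<open>J\<close>; this freedom is what makes adding a single juror a closed recurrence.\<close>

definition tail :: "('a \<Rightarrow> real) \<Rightarrow> 'a set \<Rightarrow> nat \<Rightarrow> real" where
  "tail \<epsilon> J k = (\<Sum>A | A \<subseteq> J \<and> k \<le> card A. (\<Prod>j\<in>A. \<epsilon> j) * (\<Prod>j\<in>J - A. 1 - \<epsilon> j))"

text \<open>Grouping the subsets by their size turns the single sum into the double sum of
  \<open>JER\<close>.\<close>

lemma JER_eq_tail:
  assumes "finite J"
  shows "JER \<epsilon> J = tail \<epsilon> J ((card J + 1) div 2)"
proof -
  let ?h = "(card J + 1) div 2"
  let ?S = "{A. A \<subseteq> J \<and> ?h \<le> card A}"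
  have fin: "finite ?S" using assms by simp
  have sub: "card ` ?S \<subseteq> {?h..card J}" using assms by (auto intro: card_mono)
  have "{x \<in> ?S. card x = k} = {A. A \<subseteq> J \<and> card A = k}" if "k \<in> {?h..card J}" for k
    using that by auto
  then show ?thesis
    unfolding JER_def tail_def by (subst sum.group[OF fin _ sub, symmetric]) simp_all
qed

text \<open>Threshold 0 admits every subset, and the sum over all subsets expands the product of the
  factors \<open>\<epsilon> j + (1 - \<epsilon> j)\<close>.\<close>

lemma tail_0:
  assumes "finite J"
  shows "tail \<epsilon> J 0 = 1"
proof -
  have "tail \<epsilon> J 0 = (\<Sum>A\<in>Pow J. (\<Prod>j\<in>A. \<epsilon> j) * (\<Prod>j\<in>J - A. 1 - \<epsilon> j))"
    by (simp add: tail_def Pow_def)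
  also have "\<dots> = (\<Prod>j\<in>J. \<epsilon> j + (1 - \<epsilon> j))" using assms by (rule prod_add[symmetric])
  finally show ?thesis by simp
qed

lemma tail_empty_Suc: "tail \<epsilon> {} (Suc k) = 0"
  unfolding tail_def by (rule sum.neutral) auto

text \<open>Condition on the vote of \<open>j\<close>: if \<open>j\<close> errs, \<open>k\<close>
  further wrong votes suffice; otherwise all \<open>Suc k\<close> must come from \<open>J\<close>.
  Accordingly the subsets split into those of \<open>?Y\<close> with \<open>j\<close> inserted and
  those of \<open>?X\<close>.\<close>

lemma tail_insert_Suc:
  assumes "finite J" "j \<notin> J"
  shows "tail \<epsilon> (insert j J) (Suc k) = \<epsilon> j * tail \<epsilon> J k + (1 - \<epsilon> j) * tail \<epsilon> J (Suc k)"
proof -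
  let ?f = "\<lambda>J A. (\<Prod>j\<in>A. \<epsilon> j) * (\<Prod>j\<in>J - A. 1 - \<epsilon> j)"
  let ?X = "{A. A \<subseteq> J \<and> Suc k \<le> card A}" and ?Y = "{A. A \<subseteq> J \<and> k \<le> card A}"
  have card: "card (insert j A) = Suc (card A)" if "A \<subseteq> J" for A
    using assms that by (meson card_insert_disjoint finite_subset subsetD)
  have split: "{A. A \<subseteq> insert j J \<and> Suc k \<le> card A} = ?X \<union> insert j ` ?Y"
  proof (intro equalityI subsetI)
    fix A assume A: "A \<in> {A. A \<subseteq> insert j J \<and> Suc k \<le> card A}"
    show "A \<in> ?X \<union> insert j ` ?Y"
    proof (cases "j \<in> A")
      case True
      then have eq: "A = insert j (A - {j})" and sub: "A - {j} \<subseteq> J" using A by auto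
      have "card A = Suc (card (A - {j}))" using card[OF sub] eq by simp
      then have "A - {j} \<in> ?Y" using A sub by simp
      then show ?thesis using eq by (intro UnI2 image_eqI)
    qed (use A in auto)
  qed (use card in auto)
  have inj: "inj_on (insert j) ?Y"
    using assms(2) by (intro inj_onI) (metis insert_ident mem_Collect_eq subset_iff)
  have X: "?f (insert j J) A = (1 - \<epsilon> j) * ?f J A" if "A \<in> ?X" for A
  proof -
    have "insert j J - A = insert j (J - A)" using that assms by auto
    then show ?thesis using assms by simp
  qed
  have Y: "?f (insert j J) (insert j A) = \<epsilon> j * ?f J A" if "A \<in> ?Y" for A
  proof -
    have "insert j J - insert j A = J - A" using that assms by auto
    moreover have "finite A" "j \<notin> A" using that assms finite_subset by auto
    ultimately show ?thesis by simp
  qed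
  have "tail \<epsilon> (insert j J) (Suc k) = sum (?f (insert j J)) ?X + sum (?f (insert j J)) (insert j ` ?Y)"
    unfolding tail_def split using assms by (intro sum.union_disjoint) auto
  also have "sum (?f (insert j J)) ?X = (1 - \<epsilon> j) * tail \<epsilon> J (Suc k)"
    unfolding tail_def sum_distrib_left using X by (intro sum.cong) auto
  also have "sum (?f (insert j J)) (insert j ` ?Y) = \<epsilon> j * tail \<epsilon> J k"
    unfolding tail_def sum_distrib_left sum.reindex[OF inj] o_def using Y by (intro sum.cong) auto
  finally show ?thesis by simp
qed

lemma tail_antimono:
  assumes "finite J" "\<And>j. j \<in> J \<Longrightarrow> 0 \<le> \<epsilon> j \<and> \<epsilon> j \<le> 1" "k \<le> l"
  shows "tail \<epsilon> J l \<le> tail \<epsilon> J k"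
  unfolding tail_def using assms
  by (intro sum_mono2) (auto intro!: mult_nonneg_nonneg prod_nonneg)

text \<open>By the recurrence the tail is affine in the error rate of the added juror, with slope
  \<open>tail \<epsilon> J l - tail \<epsilon> J (Suc l)\<close>, which is nonnegative.\<close>

lemma tail_replace_mono:
  assumes "finite J" "\<And>j. j \<in> J \<Longrightarrow> 0 \<le> \<epsilon> j \<and> \<epsilon> j \<le> 1" "a \<notin> J" "b \<notin> J" "\<epsilon> a \<le> \<epsilon> b"
  shows "tail \<epsilon> (insert a J) k \<le> tail \<epsilon> (insert b J) k"
proof (cases k)
  case 0
  then show ?thesis using assms by (simp add: tail_0)
next
  case (Suc l)
  have "0 \<le> (\<epsilon> b - \<epsilon> a) * (tail \<epsilon> J l - tail \<epsilon> J (Suc l))"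
    using assms tail_antimono[of J \<epsilon> l "Suc l"] by simp
  then show ?thesis using assms by (simp add: Suc tail_insert_Suc algebra_simps)
qed

text \<open>Induction on the size of \<open>A - B\<close>: replacing some \<open>b\<close> in
  \<open>B - A\<close> by some \<open>a\<close> in \<open>A - B\<close> does not raise the tail and
  brings \<open>B\<close> one element closer to \<open>A\<close>. The comparison hypothesis concerns
  only the two differences, which shrink, so it is inherited.\<close>

lemma tail_exchange:
  assumes "finite A" "finite B" "card A = card B"
    and "\<And>j. j \<in> A \<union> B \<Longrightarrow> 0 \<le> \<epsilon> j \<and> \<epsilon> j \<le> 1"
    and "\<And>a b. a \<in> A - B \<Longrightarrow> b \<in> B - A \<Longrightarrow> \<epsilon> a \<le> \<epsilon> b"
  shows "tail \<epsilon> A k \<le> tail \<epsilon> B k"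
  using assms
proof (induction "card (A - B)" arbitrary: B)
  case 0
  then have "A \<subseteq> B" by simp
  then have "A = B" using 0 by (simp add: card_subset_eq)
  then show ?case by simp
next
  case (Suc n)
  obtain a where a: "a \<in> A - B" using Suc.hyps(2) by (metis card.empty ex_in_conv nat.distinct(1))
  \<comment> \<open>Finite sets of equal size cannot be properly nested, so \<open>B - A\<close> is
    nonempty as well.\<close>
  have "\<not> B \<subseteq> A" using a Suc.prems by (metis DiffE card_subset_eq)
  then obtain b where b: "b \<in> B - A" by auto
  let ?C = "B - {b}"
  have "tail \<epsilon> A k \<le> tail \<epsilon> (insert a ?C) k"
  proof (rule Suc.hyps(1))
    have "A - insert a ?C = (A - B) - {a}" using a b by auto
    then show "n = card (A - insert a ?C)" using Suc.hyps(2) a Suc.prems(1) by simp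
    have "card (insert a ?C) = Suc (card ?C)" using a Suc.prems(2) by simp
    also have "\<dots> = card B" using b Suc.prems(2) by (intro card_Suc_Diff1) auto
    finally show "card A = card (insert a ?C)" using Suc.prems(3) by simp
  qed (use Suc.prems a b in auto)
  also have "\<dots> \<le> tail \<epsilon> (insert b ?C) k"
    using Suc.prems a b by (intro tail_replace_mono) auto
  also have "insert b ?C = B" using b by auto
  finally show ?case .
qed


section \<open>Time-bounded weakest preconditions\<close>

text \<open>The time is only bounded from above, so that branches of different cost can share one
  bound.\<close>

definition wp :: "com \<Rightarrow> nat \<Rightarrow> (state \<Rightarrow> bool) \<Rightarrow> state \<Rightarrow> bool" where
  "wp P t B s \<longleftrightarrow> (\<exists>u s'. run P s u s' \<and> u \<le> t \<and> B s')"

lemma wp_mono: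
  assumes "wp P t B s" "t \<le> t'" "\<And>s'. B s' \<Longrightarrow> B' s'"
  shows "wp P t' B' s"
  using assms unfolding wp_def by (meson order_trans)

lemma wp_Seq:
  assumes "wp P t B s" "\<And>s'. B s' \<Longrightarrow> wp Q u C s'" "t + u \<le> v"
  shows "wp (Seq P Q) v C s"
  using assms unfolding wp_def by (meson add_mono order_trans run_Seq)

lemma wp_Cond:
  assumes "holds b s \<Longrightarrow> wp P (t - 1) B s" "\<not> holds b s \<Longrightarrow> wp Q (t - 1) B s" "1 \<le> t"
  shows "wp (Cond b P Q) t B s"
proof (cases "holds b s")
  case True
  then obtain u s' where "run P s u s'" "u \<le> t - 1" "B s'" using assms(1) by (auto simp: wp_def)
  then show ?thesis
    using True assms(3) run_Cond_True unfolding wp_def by (metis le_diff_conv2)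
next
  case False
  then obtain u s' where "run Q s u s'" "u \<le> t - 1" "B s'" using assms(2) by (auto simp: wp_def)
  then show ?thesis
    using False assms(3) run_Cond_False unfolding wp_def by (metis le_diff_conv2)
qed

text \<open>The counter \<open>i\<close> is a parameter of the invariant and need not be stored in a
  register. Each round costs the body and one test; the final failing test is the additional
  1.\<close>

lemma wp_for:
  assumes "I i s" "i \<le> n"
    and "\<And>i s. I i s \<Longrightarrow> i < n \<Longrightarrow> holds b s \<and> wp P t (I (Suc i)) s"
    and "\<And>s. I n s \<Longrightarrow> \<not> holds b s"
  shows "wp (While b P) ((n - i) * (t + 1) + 1) (I n) s"
  using assms(1,2)
proof (induction "n - i" arbitrary: i s)
  case 0
  then show ?case using assms(4)[of s] unfolding wp_def
    by (metis diff_is_0_eq dual_order.antisym le_add2 run_While_False)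
next
  case (Suc d)
  then have "i < n" by simp
  then obtain u s' where 1: "run P s u s'" "u \<le> t" "I (Suc i) s'" "holds b s"
    using assms(3)[OF Suc.prems(1)] unfolding wp_def by blast
  have "wp (While b P) ((n - Suc i) * (t + 1) + 1) (I n) s'"
    using Suc.hyps(2) \<open>i < n\<close> 1 by (intro Suc.hyps(1)) auto
  then obtain v s'' where 2: "run (While b P) s' v s''" "v \<le> (n - Suc i) * (t + 1) + 1" "I n s''"
    by (auto simp: wp_def)
  have "n - i = Suc (n - Suc i)" using \<open>i < n\<close> by simp
  then have "u + v + 1 \<le> (n - i) * (t + 1) + 1" using 1 2 by simp
  then show ?case using 1 2 run_While_True unfolding wp_def by blast
qed

text \<open>The empty list has no clause, since every command takes at least one unit of
  time.\<close>

fun block :: "instr list \<Rightarrow> com" where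
  "block [c] = Do c"
| "block (c # cs) = Seq (Do c) (block cs)"

lemma run_block: "cs \<noteq> [] \<Longrightarrow> run (block cs) s (length cs) (fold step cs s)"
proof (induction cs arbitrary: s rule: block.induct)
  case (2 c d ds)
  then show ?case using run_Seq[OF run_Do[of c s]] by fastforce
qed (use run_Do in auto)

lemma wp_block:
  assumes "cs \<noteq> []" "B (fold step cs s)" "length cs \<le> t"
  shows "wp (block cs) t B s"
  using assms run_block unfolding wp_def by blast


text \<open>The intermediate assertion is equality with the state after \<open>cs\<close>, so
  straight-line code is executed symbolically by simplification.\<close>

lemma wp_block_Seq:
  assumes "cs \<noteq> []" "length cs \<le> t" "wp Q (t - length cs) B (fold step cs s)"
  shows "wp (Seq (block cs) Q) t B s"
  by (rule wp_Seq[OF wp_block[where B = "\<lambda>s'. s' = fold step cs s" and t = "length cs"]])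
    (use assms in auto)

lemma wp_block_for:
  assumes "cs \<noteq> []" "I 0 (fold step cs s)"
    and "\<And>i s. I i s \<Longrightarrow> i < n \<Longrightarrow> holds b s \<and> wp P t (I (Suc i)) s"
    and "\<And>s. I n s \<Longrightarrow> \<not> holds b s" "\<And>s. I n s \<Longrightarrow> B s"
    and "length cs + n * (t + 1) + 1 \<le> t'"
  shows "wp (Seq (block cs) (While b P)) t' B s"
proof (rule wp_block_Seq[OF assms(1)])
  have "wp (While b P) ((n - 0) * (t + 1) + 1) (I n) (fold step cs s)"
    using assms by (intro wp_for) auto
  then show "wp (While b P) (t' - length cs) B (fold step cs s)"
    by (rule wp_mono) (use assms in auto)
qed (use assms in simp)


section \<open>The program\<close>

text \<open>Register \<open>zero\<close> keeps its initial value 0 throughout and serves as that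
  constant; copying it to itself changes nothing.\<close>

abbreviation skip :: com where
  "skip \<equiv> block [NMove ''zero'' ''zero'']"

text \<open>The array \<open>rank\<close> holds 0 for a juror not yet selected and otherwise the
  position in the selection order.\<close>

definition find_min_body :: com where
  "find_min_body =
    Seq (block [NSucc ''i'' ''i'', NLoad ''x'' ''rank'' ''i''])
      (Cond (NEq ''x'' ''zero'')
        (Seq (block [RLoad ''v'' ''eps'' ''i''])
          (Cond (RLess ''v'' ''cv'') (block [RMove ''cv'' ''v'', NMove ''c'' ''i'']) skip))
        skip)"

definition find_min :: com where
  "find_min =
    Seq (block [RMove ''cv'' ''one'', NConst ''i'' 0]) (While (NLess ''i'' ''N'') find_min_body)"

definition mark :: com where
  "mark = block [NSucc ''m'' ''m'', NStore ''rank'' ''c'' ''m'']"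

text \<open>\<open>q\<close> is updated in place from the top down, so that \<open>q[k - 1]\<close> still holds the old value.\<close>

definition update_tail_body :: com where
  "update_tail_body = block [NPred ''l'' ''k'', RLoad ''a'' ''q'' ''l'', RLoad ''b'' ''q'' ''k'',
      RMult ''a'' ''a'' ''cv'', RMult ''b'' ''b'' ''d'', RAdd ''a'' ''a'' ''b'',
      RStore ''q'' ''k'' ''a'', NMove ''k'' ''l'']"

text \<open>All indices from \<open>N\<close> down to 1 are processed whatever the current jury
  size: tails beyond that size are 0 and obey the same recurrence. Index 0 keeps the value
  1.\<close>

definition update_tail :: com where
  "update_tail =
    Seq (block [RSub ''d'' ''one'' ''cv'', NMove ''k'' ''N'']) (While (NLess ''zero'' ''k'') update_tail_body)"

text \<open>On entry \<open>par\<close> is the parity of the previous prefix size and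
  \<open>h\<close> its majority threshold. Carrying both along avoids halving an index, for which
  there is no instruction.\<close>

definition update_best :: com where
  "update_best =
    Cond (NEq ''par'' ''zero'')
      (Seq (block [NConst ''par'' 1, NSucc ''h'' ''h'', RLoad ''v'' ''q'' ''h''])
        (Cond (RLess ''v'' ''bestv'') (block [RMove ''bestv'' ''v'', NMove ''bestm'' ''m'']) skip))
      (block [NConst ''par'' 0])"

text \<open>The ranks describe all prefixes at once, so the best jury is recovered from its size
  \<open>bestm\<close> alone.\<close>

definition emit_body :: com where
  "emit_body =
    Seq (block [NSucc ''i'' ''i'', NLoad ''x'' ''rank'' ''i''])
      (Cond (NLess ''bestm'' ''x'') skip (block [NStore ''jury'' ''i'' ''u'']))"

definition emit :: com where
  "emit = Seq (block [NConst ''i'' 0, NConst ''u'' 1]) (While (NLess ''i'' ''N'') emit_body)"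

definition select_jury_body :: com where
  "select_jury_body = Seq find_min (Seq mark (Seq update_tail update_best))"

definition select_jury :: com where
  "select_jury =
    Seq (Seq (block [RConst ''one'' 1, RConst ''bestv'' 2, RStore ''q'' ''zero'' ''one''])
        (While (NLess ''m'' ''N'') select_jury_body))
      emit"

text \<open>The initial value \<open>1\<close> of the minimum exceeds every error rate.\<close>

definition unranked_min :: "(nat \<Rightarrow> real) \<Rightarrow> (nat \<Rightarrow> nat) \<Rightarrow> nat \<Rightarrow> real \<Rightarrow> nat \<Rightarrow> bool" where
  "unranked_min e r n v c \<longleftrightarrow> (\<forall>j\<in>{1..n}. r j = 0 \<longrightarrow> v \<le> e j) \<and>
    (v = 1 \<or> c \<in> {1..n} \<and> r c = 0 \<and> v = e c)"

lemma unranked_min_0: "unranked_min e r 0 1 c"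
  by (simp add: unranked_min_def)

lemma unranked_min_ranked:
  "unranked_min e r n v c \<Longrightarrow> r (Suc n) \<noteq> 0 \<Longrightarrow> unranked_min e r (Suc n) v c"
  by (auto simp: unranked_min_def atLeastAtMostSuc_conv)

lemma unranked_min_less:
  "unranked_min e r n v c \<Longrightarrow> r (Suc n) = 0 \<Longrightarrow> e (Suc n) < v \<Longrightarrow>
    unranked_min e r (Suc n) (e (Suc n)) (Suc n)"
  by (force simp: unranked_min_def atLeastAtMostSuc_conv)

lemma unranked_min_not_less:
  "unranked_min e r n v c \<Longrightarrow> \<not> e (Suc n) < v \<Longrightarrow> unranked_min e r (Suc n) v c"
  by (auto simp: unranked_min_def atLeastAtMostSuc_conv)

definition min_found :: "state \<Rightarrow> nat \<Rightarrow> state \<Rightarrow> bool" where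
  "min_found s n s' \<longleftrightarrow> narr s' = narr s \<and> rarr s' = rarr s \<and>
      (\<forall>y. y \<notin> {''i'', ''x'', ''c''} \<longrightarrow> nreg s' y = nreg s y) \<and>
      (\<forall>y. y \<notin> {''v'', ''cv''} \<longrightarrow> rreg s' y = rreg s y) \<and>
      unranked_min (rarr s ''eps'') (narr s ''rank'') n (rreg s' ''cv'') (nreg s' ''c'')"

text \<open>The longest path costs 7: two instructions, a test, a load, a second test and two
  moves.\<close>

lemma wp_find_min_body:
  assumes "min_found s n s'" "nreg s' ''i'' = n" "nreg s ''zero'' = 0"
  shows "wp find_min_body 7 (\<lambda>s''. nreg s'' ''i'' = Suc n \<and> min_found s (Suc n) s'') s'"
  unfolding find_min_body_def
  by (intro wp_block_Seq wp_Cond wp_block)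
    (use assms in \<open>simp_all add: min_found_def unranked_min_ranked unranked_min_not_less
      unranked_min_less[where v = "rreg s' ''cv''" and c = "nreg s' ''c''"]\<close>)

lemma wp_find_min:
  assumes "nreg s ''N'' = n" "nreg s ''zero'' = 0" "rreg s ''one'' = 1"
  shows "wp find_min (8 * n + 3) (min_found s n) s"
  unfolding find_min_def
proof (rule wp_block_for[where I = "\<lambda>i s'. nreg s' ''i'' = i \<and> min_found s i s'" and t = 7 and n = n])
  show "holds (NLess ''i'' ''N'') s' \<and>
      wp find_min_body 7 (\<lambda>s''. nreg s'' ''i'' = Suc i \<and> min_found s (Suc i) s'') s'"
    if "nreg s' ''i'' = i \<and> min_found s i s'" "i < n" for i s'
    using that assms wp_find_min_body[of s i s'] by (simp add: min_found_def)
qed (use assms in \<open>auto simp: min_found_def unranked_min_0\<close>)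

text \<open>The contents of \<open>q\<close> when the \<open>i\<close> topmost of the entries \<open>1, \<dots>, n\<close> have been updated.\<close>

definition mixed :: "real \<Rightarrow> (nat \<Rightarrow> real) \<Rightarrow> nat \<Rightarrow> nat \<Rightarrow> nat \<Rightarrow> real" where
  "mixed p q n i j = (if n - i < j \<and> j \<le> n then p * q (j - 1) + (1 - p) * q j else q j)"

lemma mixed_0: "mixed p q n 0 = q"
  by (auto simp: mixed_def)

lemma mixed_below: "j \<le> n - i \<Longrightarrow> mixed p q n i j = q j"
  by (simp add: mixed_def)

text \<open>Both entries that are read lie outside the part already overwritten. The factors stand
  in the order in which the program multiplies, so that the equation rewrites the executed
  state.\<close>

lemma mixed_Suc:
  assumes "i < n"
  shows "(mixed p q n i)(n - i := q (n - Suc i) * p + q (n - i) * (1 - p)) = mixed p q n (Suc i)"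
proof
  fix j
  consider "j = n - i" | "j < n - i" | "n - i < j" by linarith
  then show "((mixed p q n i)(n - i := q (n - Suc i) * p + q (n - i) * (1 - p))) j = mixed p q n (Suc i) j"
    by cases (use assms in \<open>auto simp: mixed_def\<close>)
qed

definition tail_updated :: "nat \<Rightarrow> state \<Rightarrow> nat \<Rightarrow> state \<Rightarrow> bool" where
  "tail_updated n s i s' \<longleftrightarrow> narr s' = narr s \<and>
      (\<forall>y. y \<notin> {''k'', ''l''} \<longrightarrow> nreg s' y = nreg s y) \<and>
      (\<forall>y. y \<notin> {''a'', ''b'', ''d''} \<longrightarrow> rreg s' y = rreg s y) \<and>
      rarr s' = (rarr s)(''q'' := mixed (rreg s ''cv'') (rarr s ''q'') n i) \<and>
      nreg s' ''k'' = n - i \<and> rreg s' ''d'' = 1 - rreg s ''cv''"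

lemma wp_update_tail_body:
  assumes "tail_updated n s i s'" "i < n"
  shows "wp update_tail_body 8 (tail_updated n s (Suc i)) s'"
  unfolding update_tail_body_def
  by (rule wp_block) (use assms in \<open>simp_all add: tail_updated_def mixed_below mixed_Suc\<close>)

lemma wp_update_tail:
  assumes "nreg s ''N'' = n" "nreg s ''zero'' = 0" "rreg s ''one'' = 1"
  shows "wp update_tail (9 * n + 3) (tail_updated n s n) s"
  unfolding update_tail_def
proof (rule wp_block_for[where I = "tail_updated n s" and t = 8 and n = n])
  show "holds (NLess ''zero'' ''k'') s' \<and> wp update_tail_body 8 (tail_updated n s (Suc i)) s'"
    if "tail_updated n s i s'" "i < n" for i s'
    using that assms wp_update_tail_body[of n s i s'] by (simp add: tail_updated_def)
qed (use assms in \<open>auto simp: tail_updated_def mixed_0\<close>)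


section \<open>Selection in order of increasing error rate\<close>

definition selected :: "nat \<Rightarrow> (nat \<Rightarrow> nat) \<Rightarrow> nat \<Rightarrow> nat set" where
  "selected N r k = {j \<in> {1..N}. 1 \<le> r j \<and> r j \<le> k}"

text \<open>Demanding size \<open>k\<close> of every prefix says that each rank from 1 to
  \<open>m\<close> is used exactly once. The comparison of a prefix with its complement is what the
  exchange argument consumes.\<close>

definition ranking :: "nat \<Rightarrow> (nat \<Rightarrow> real) \<Rightarrow> (nat \<Rightarrow> nat) \<Rightarrow> nat \<Rightarrow> bool" where
  "ranking N \<epsilon> r m \<longleftrightarrow> (\<forall>j\<in>{1..N}. r j \<le> m) \<and>
    (\<forall>k\<le>m. card (selected N r k) = k \<and>
      (\<forall>u\<in>selected N r k. \<forall>v\<in>{1..N} - selected N r k. \<epsilon> u \<le> \<epsilon> v))"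

text \<open>If the prefix has \<open>k\<close> members, this is its \<open>JER\<close> by
  \<open>JER_eq_tail\<close>.\<close>

definition prefix_error :: "nat \<Rightarrow> (nat \<Rightarrow> real) \<Rightarrow> (nat \<Rightarrow> nat) \<Rightarrow> nat \<Rightarrow> real" where
  "prefix_error N \<epsilon> r k = tail \<epsilon> (selected N r k) ((k + 1) div 2)"

lemma finite_selected [simp]: "finite (selected N r k)"
  by (simp add: selected_def)

lemma selected_subset: "selected N r k \<subseteq> {1..N}"
  by (auto simp: selected_def)

lemma selected_0 [simp]: "selected N r 0 = {}"
  by (auto simp: selected_def)

lemma ranking_0: "(\<And>j. j \<in> {1..N} \<Longrightarrow> r j = 0) \<Longrightarrow> ranking N \<epsilon> r 0"
  by (auto simp: ranking_def)

text \<open>Only \<open>m\<close> of the \<open>N\<close> jurors are selected, so one is left over;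
  as no rank exceeds \<open>m\<close>, its rank must be 0.\<close>

lemma ranking_unranked:
  assumes "ranking N \<epsilon> r m" "m < N"
  obtains j where "j \<in> {1..N}" "r j = 0"
proof -
  have "card (selected N r m) \<noteq> card {1..N}" using assms by (simp add: ranking_def)
  then have "\<not> {1..N} \<subseteq> selected N r m" using selected_subset by (metis subset_antisym)
  then obtain j where "j \<in> {1..N}" "j \<notin> selected N r m" by blast
  moreover have "r j \<le> m" using assms(1) \<open>j \<in> {1..N}\<close> by (simp add: ranking_def)
  ultimately show ?thesis using that[of j] by (simp add: selected_def)
qed

lemma ranking_full:
  assumes "ranking N \<epsilon> r N"
  shows "selected N r N = {1..N}"
  by (rule card_subset_eq[OF _ selected_subset]) (use assms in \<open>simp_all add: ranking_def\<close>)

lemma selected_upd: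
  assumes "r c = 0" "k \<le> m"
  shows "selected N (r(c := Suc m)) k = selected N r k"
  using assms by (auto simp: selected_def)

lemma selected_upd_Suc:
  assumes "\<And>j. j \<in> {1..N} \<Longrightarrow> r j \<le> m" "c \<in> {1..N}"
  shows "selected N (r(c := Suc m)) (Suc m) = insert c (selected N r m)"
proof (intro equalityI subsetI)
  show "j \<in> insert c (selected N r m)" if "j \<in> selected N (r(c := Suc m)) (Suc m)" for j
    using that assms(1)[of j] by (cases "j = c") (simp_all add: selected_def)
  show "j \<in> selected N (r(c := Suc m)) (Suc m)" if "j \<in> insert c (selected N r m)" for j
    using that assms(2) by (cases "j = c") (simp_all add: selected_def)
qed

text \<open>Prefixes up to size \<open>m\<close> are unchanged. In the new one, the old members are
  covered by the old ranking and \<open>c\<close> by its minimality among the jurors left.\<close>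

lemma ranking_upd:
  assumes r: "ranking N \<epsilon> r m" and c: "c \<in> {1..N}" "r c = 0"
    and min: "\<And>j. j \<in> {1..N} \<Longrightarrow> r j = 0 \<Longrightarrow> \<epsilon> c \<le> \<epsilon> j"
  shows "ranking N \<epsilon> (r(c := Suc m)) (Suc m)"
proof -
  have le: "r j \<le> m" if "j \<in> {1..N}" for j using r that by (simp add: ranking_def)
  let ?U = "selected N r m" and ?r = "r(c := Suc m)"
  have "c \<notin> ?U" using c(2) by (simp add: selected_def)
  moreover have "card ?U = m" using r unfolding ranking_def by blast
  ultimately have card: "card (insert c ?U) = Suc m" by simp
  have cross: "\<epsilon> u \<le> \<epsilon> v" if "u \<in> insert c ?U" "v \<in> {1..N} - insert c ?U" for u v
  proof (cases "u = c")
    case True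
    have v: "v \<in> {1..N}" "v \<notin> ?U" using that(2) by auto
    then have "r v = 0" using le[OF v(1)] by (simp add: selected_def)
    then show ?thesis using True v min by simp
  next
    case False
    then have "u \<in> ?U" "v \<in> {1..N} - ?U" using that by auto
    then show ?thesis using r unfolding ranking_def by blast
  qed
  have "card (selected N ?r k) = k \<and>
      (\<forall>u\<in>selected N ?r k. \<forall>v\<in>{1..N} - selected N ?r k. \<epsilon> u \<le> \<epsilon> v)" if "k \<le> Suc m" for k
  proof (cases "k = Suc m")
    case True
    have eq: "selected N ?r (Suc m) = insert c ?U" using le c(1) by (rule selected_upd_Suc)
    show ?thesis unfolding True eq by (intro conjI ballI card cross)
  next
    case False
    then have "k \<le> m" using that by simp
    then have "selected N ?r k = selected N r k" using c(2) by (simp add: selected_upd)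
    then show ?thesis using r \<open>k \<le> m\<close> by (metis ranking_def)
  qed
  moreover have "?r j \<le> Suc m" if "j \<in> {1..N}" for j
    using le[OF that] by simp
  ultimately show ?thesis by (simp only: ranking_def) blast
qed

text \<open>The prefix and \<open>J\<close> have equal size, hence the same threshold, and no juror
  outside the prefix has a smaller error rate than one inside, so \<open>tail_exchange\<close>
  applies.\<close>

lemma prefix_error_le:
  assumes r: "ranking N \<epsilon> r N" and "\<And>j. j \<in> {1..N} \<Longrightarrow> 0 < \<epsilon> j \<and> \<epsilon> j < 1" "J \<subseteq> {1..N}"
  shows "prefix_error N \<epsilon> r (card J) \<le> tail \<epsilon> J ((card J + 1) div 2)"
  unfolding prefix_error_def
proof (rule tail_exchange)
  have "card J \<le> N" using card_mono[OF _ assms(3)] by simp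
  then show "card (selected N r (card J)) = card J" using r by (simp add: ranking_def)
  show "\<epsilon> a \<le> \<epsilon> b" if "a \<in> selected N r (card J) - J" "b \<in> J - selected N r (card J)" for a b
  proof -
    have "a \<in> selected N r (card J)" "b \<in> {1..N} - selected N r (card J)" using that assms(3) by auto
    then show ?thesis using r \<open>card J \<le> N\<close> unfolding ranking_def by blast
  qed
  show "0 \<le> \<epsilon> j \<and> \<epsilon> j \<le> 1" if "j \<in> selected N r (card J) \<union> J" for j
  proof -
    have "j \<in> {1..N}" using that assms(3) selected_subset[of N r "card J"] by blast
    then show ?thesis using assms(2)[of j] by simp
  qed
  show "finite J" using assms(3) finite_subset by blast
qed simp

lemma prefix_error_upd:
  assumes "r c = 0" "k \<le> m"
  shows "prefix_error N \<epsilon> (r(c := Suc m)) k = prefix_error N \<epsilon> r k"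
  unfolding prefix_error_def selected_upd[of r c, OF assms] by (rule refl)

text \<open>This guarantees that the first comparison replaces the initial value 2.\<close>

lemma prefix_error_le_1:
  assumes "\<And>j. j \<in> {1..N} \<Longrightarrow> 0 < \<epsilon> j \<and> \<epsilon> j < 1"
  shows "prefix_error N \<epsilon> r k \<le> 1"
proof -
  have "0 \<le> \<epsilon> j \<and> \<epsilon> j \<le> 1" if "j \<in> selected N r k" for j
    using assms[of j] that by (simp add: selected_def)
  then have "prefix_error N \<epsilon> r k \<le> tail \<epsilon> (selected N r k) 0"
    unfolding prefix_error_def by (intro tail_antimono) simp_all
  then show ?thesis by (simp add: tail_0)
qed

text \<open>The initial value \<open>2\<close> of the best error rate exceeds every probability.\<close>

definition best_found :: "nat \<Rightarrow> (nat \<Rightarrow> real) \<Rightarrow> (nat \<Rightarrow> nat) \<Rightarrow> nat \<Rightarrow> nat \<Rightarrow> real \<Rightarrow> bool" where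
  "best_found N \<epsilon> r p n v \<longleftrightarrow>
    (if p = 0 then v = 2 else odd n \<and> n \<le> p \<and> v = prefix_error N \<epsilon> r n) \<and>
    (\<forall>k\<le>p. odd k \<longrightarrow> v \<le> prefix_error N \<epsilon> r k)"

lemma best_found_0: "best_found N \<epsilon> r 0 n 2"
  by (simp add: best_found_def)

lemma best_found_upd:
  assumes "best_found N \<epsilon> r m n v" "r c = 0"
  shows "best_found N \<epsilon> (r(c := Suc m)) m n v"
  using assms(1) prefix_error_upd[of r c _ m N \<epsilon>, OF assms(2)]
  by (simp add: best_found_def del: fun_upd_apply split: if_splits)

text \<open>The size \<open>Suc p\<close> is even, so no new jury enters the comparison.\<close>

lemma best_found_skip: "best_found N \<epsilon> r p n v \<Longrightarrow> odd p \<Longrightarrow> best_found N \<epsilon> r (Suc p) n v"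
  by (auto simp: best_found_def le_Suc_eq elim: oddE)

lemma best_found_better:
  assumes "best_found N \<epsilon> r p n v" "even p" "prefix_error N \<epsilon> r (Suc p) < v"
  shows "best_found N \<epsilon> r (Suc p) (Suc p) (prefix_error N \<epsilon> r (Suc p))"
proof -
  have "prefix_error N \<epsilon> r (Suc p) \<le> prefix_error N \<epsilon> r k" if "k \<le> Suc p" "odd k" for k
  proof (cases "k = Suc p")
    case False
    then have "v \<le> prefix_error N \<epsilon> r k" using assms(1) that unfolding best_found_def by simp
    then show ?thesis using assms(3) by simp
  qed simp
  then show ?thesis using assms(2) by (simp add: best_found_def)
qed

lemma best_found_keep:
  assumes "best_found N \<epsilon> r p n v" "\<not> prefix_error N \<epsilon> r (Suc p) < v" "prefix_error N \<epsilon> r (Suc p) \<le> 1"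
  shows "best_found N \<epsilon> r (Suc p) n v"
proof -
  \<comment> \<open>With nothing recorded yet, \<open>v\<close> would be 2 and the new prefix, whose
    error is at most 1, would have won.\<close>
  have "p \<noteq> 0"
  proof
    assume "p = 0"
    then have "v = 2" using assms(1) by (simp add: best_found_def)
    then show False using assms(2,3) by simp
  qed
  moreover have "v \<le> prefix_error N \<epsilon> r k" if "k \<le> Suc p" "odd k" for k
    using that assms unfolding best_found_def by (cases "k = Suc p") simp_all
  ultimately show ?thesis using assms(1) by (simp add: best_found_def)
qed


section \<open>Correctness and running time\<close>

text \<open>\<open>m\<close> jurors have been ranked, and the prefixes up to size \<open>p\<close> have been compared.\<close>

definition loop_inv :: "nat \<Rightarrow> (nat \<Rightarrow> real) \<Rightarrow> nat \<Rightarrow> nat \<Rightarrow> state \<Rightarrow> bool" where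
  "loop_inv N \<epsilon> m p s \<longleftrightarrow>
    nreg s ''N'' = N \<and> nreg s ''zero'' = 0 \<and> nreg s ''m'' = m \<and>
    nreg s ''par'' = p mod 2 \<and> nreg s ''h'' = (p + 1) div 2 \<and> rreg s ''one'' = 1 \<and>
    (\<forall>j\<in>{1..N}. rarr s ''eps'' j = \<epsilon> j) \<and> narr s ''jury'' = (\<lambda>_. 0) \<and>
    ranking N \<epsilon> (narr s ''rank'') m \<and>
    (\<forall>k\<le>N. rarr s ''q'' k = tail \<epsilon> (selected N (narr s ''rank'') m) k) \<and>
    best_found N \<epsilon> (narr s ''rank'') p (nreg s ''bestm'') (rreg s ''bestv'')"

text \<open>A new odd size arises only for even \<open>p\<close>. Writing \<open>p\<close> as
  \<open>2 * t\<close> or \<open>2 * t + 1\<close> lets the simplifier evaluate parity and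
  threshold.\<close>

lemma wp_update_best:
  assumes inv: "loop_inv N \<epsilon> (Suc p) p s" and "Suc p \<le> N"
    and \<epsilon>: "\<And>j. j \<in> {1..N} \<Longrightarrow> 0 < \<epsilon> j \<and> \<epsilon> j < 1"
  shows "wp update_best 7 (loop_inv N \<epsilon> (Suc p) (Suc p)) s"
proof (cases "even p")
  case True
  then obtain t where p: "p = 2 * t" by (elim evenE)
  \<comment> \<open>The new size is \<open>2 * t + 1\<close>, whose majority threshold
    \<open>Suc t\<close> is at most \<open>N\<close> and so within the maintained part of
    \<open>q\<close>.\<close>
  have q: "rarr s ''q'' (Suc t) = prefix_error N \<epsilon> (narr s ''rank'') (Suc p)"
    using inv assms(2) by (simp add: loop_inv_def prefix_error_def p)
  note best = best_found_better[of N \<epsilon> "narr s ''rank''" p "nreg s ''bestm''" "rreg s ''bestv''", OF _ True]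
    best_found_keep[of N \<epsilon> "narr s ''rank''" p "nreg s ''bestm''" "rreg s ''bestv''",
      OF _ _ prefix_error_le_1[OF \<epsilon>]]
  show ?thesis
    unfolding update_best_def
    by (intro wp_Cond wp_block_Seq wp_block)
      (use inv q best in \<open>simp_all add: loop_inv_def p\<close>)
next
  case False
  then obtain t where p: "p = 2 * t + 1" by (elim oddE)
  have regs: "nreg s ''zero'' = 0" "nreg s ''par'' = 1" using inv by (simp_all add: loop_inv_def p)
  show ?thesis
    unfolding update_best_def
    by (intro wp_Cond wp_block_Seq wp_block)
      (use regs inv best_found_skip[OF _ False] in \<open>simp_all add: loop_inv_def p\<close>)
qed

text \<open>The bound adds \<open>8 * N + 3\<close> for the scan, 2 for marking,
  \<open>9 * N + 3\<close> for the tail update and 7 for the comparison.\<close>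

lemma wp_select_jury_body:
  assumes inv: "loop_inv N \<epsilon> m m s" and "m < N"
    and \<epsilon>: "\<And>j. j \<in> {1..N} \<Longrightarrow> 0 < \<epsilon> j \<and> \<epsilon> j < 1"
  shows "wp select_jury_body (17 * N + 15) (loop_inv N \<epsilon> (Suc m) (Suc m)) s"
proof -
  let ?r = "narr s ''rank''"
  let ?U = "selected N ?r m"
  have regs: "nreg s ''N'' = N" "nreg s ''zero'' = 0" "rreg s ''one'' = 1" "nreg s ''m'' = m"
    and eps: "\<And>j. j \<in> {1..N} \<Longrightarrow> rarr s ''eps'' j = \<epsilon> j"
    and r: "ranking N \<epsilon> ?r m"
    and q: "\<And>k. k \<le> N \<Longrightarrow> rarr s ''q'' k = tail \<epsilon> ?U k"
    and best: "best_found N \<epsilon> ?r m (nreg s ''bestm'') (rreg s ''bestv'')"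
    using inv unfolding loop_inv_def by blast+
  show ?thesis
    unfolding select_jury_body_def
  proof (rule wp_Seq[OF wp_find_min[OF regs(1-3)]])
    fix s1 assume s1: "min_found s N s1"
    let ?c = "nreg s1 ''c''"
    let ?r' = "?r(?c := Suc m)"
    have min: "unranked_min (rarr s ''eps'') ?r N (rreg s1 ''cv'') ?c"
      using s1 unfolding min_found_def by blast
    obtain j where j: "j \<in> {1..N}" "?r j = 0" using r \<open>m < N\<close> by (rule ranking_unranked)
    then have "rreg s1 ''cv'' \<le> \<epsilon> j" using min eps unfolding unranked_min_def by metis
    \<comment> \<open>The unranked juror \<open>j\<close> has error rate below 1, so the scan has
      left its default value and \<open>?c\<close> is a genuine minimizer.\<close>
    then have "rreg s1 ''cv'' \<noteq> 1" using \<epsilon>[OF j(1)] by simp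
    then have c: "?c \<in> {1..N}" "?r ?c = 0" and cv: "rreg s1 ''cv'' = \<epsilon> ?c"
      using min eps unfolding unranked_min_def by metis+
    have c_min: "\<epsilon> ?c \<le> \<epsilon> i" if "i \<in> {1..N}" "?r i = 0" for i
      using min that eps cv unfolding unranked_min_def by metis
    have r': "ranking N \<epsilon> ?r' (Suc m)" using r c c_min by (rule ranking_upd)
    have "\<And>i. i \<in> {1..N} \<Longrightarrow> ?r i \<le> m" using r unfolding ranking_def by blast
    then have U': "selected N ?r' (Suc m) = insert ?c ?U" using c(1) by (rule selected_upd_Suc)
    have "?c \<notin> ?U" using c(2) by (simp add: selected_def)
    then have tail_U': "tail \<epsilon> (insert ?c ?U) (Suc k) = \<epsilon> ?c * tail \<epsilon> ?U k + (1 - \<epsilon> ?c) * tail \<epsilon> ?U (Suc k)" for k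
      by (rule tail_insert_Suc[OF finite_selected])
    have mixed: "mixed (\<epsilon> ?c) (rarr s ''q'') N N k = tail \<epsilon> (insert ?c ?U) k" if "k \<le> N" for k
      using that q by (cases k) (simp_all add: mixed_def tail_0 tail_U')
    have best': "best_found N \<epsilon> ?r' m (nreg s ''bestm'') (rreg s ''bestv'')"
      using best c(2) by (rule best_found_upd)
    let ?s2 = "fold step [NSucc ''m'' ''m'', NStore ''rank'' ''c'' ''m''] s1"
    show "wp (Seq mark (Seq update_tail update_best)) (9 * N + 12) (loop_inv N \<epsilon> (Suc m) (Suc m)) s1"
      unfolding mark_def
    proof (rule wp_block_Seq)
      have "wp (Seq update_tail update_best) (9 * N + 10) (loop_inv N \<epsilon> (Suc m) (Suc m)) ?s2"
      proof (rule wp_Seq[OF wp_update_tail[where n = N]])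
        fix s3 assume s3: "tail_updated N ?s2 N s3"
        \<comment> \<open>The new juror is ranked but the enlarged prefix is not yet compared, hence
          the two different indices.\<close>
        have "loop_inv N \<epsilon> (Suc m) m s3"
          using s3 s1 inv eps r' best' mixed unfolding tail_updated_def min_found_def loop_inv_def
          by (simp add: cv U' del: fun_upd_apply) (simp add: U')
        then show "wp update_best 7 (loop_inv N \<epsilon> (Suc m) (Suc m)) s3"
          using \<open>m < N\<close> by (intro wp_update_best \<epsilon>) simp_all
      qed (use s1 regs in \<open>simp_all add: min_found_def\<close>)
      then show "wp (Seq update_tail update_best)
          (9 * N + 12 - length [NSucc ''m'' ''m'', NStore ''rank'' ''c'' ''m''])
          (loop_inv N \<epsilon> (Suc m) (Suc m)) ?s2"
        by (rule wp_mono) simp_all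
    qed simp_all
  qed simp
qed

lemma wp_emit:
  assumes "nreg s ''N'' = N" "narr s ''jury'' = (\<lambda>_. 0)"
  shows "wp emit (5 * N + 3)
    (\<lambda>s'. output_jury N s' = {i \<in> {1..N}. narr s ''rank'' i \<le> nreg s ''bestm''}) s"
proof -
  \<comment> \<open>Entries not reached yet still hold the initial 0, so non-members never have to
    be written.\<close>
  define I where "I = (\<lambda>n (s' :: state). nreg s' ''i'' = n \<and> nreg s' ''u'' = 1 \<and> nreg s' ''N'' = N \<and>
    nreg s' ''bestm'' = nreg s ''bestm'' \<and> narr s' ''rank'' = narr s ''rank'' \<and>
    narr s' ''jury'' = (\<lambda>j. if 1 \<le> j \<and> j \<le> n \<and> narr s ''rank'' j \<le> nreg s ''bestm'' then 1 else 0))"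
  show ?thesis
    unfolding emit_def
  proof (rule wp_block_for[where I = I and t = 4 and n = N])
    show "holds (NLess ''i'' ''N'') s' \<and> wp emit_body 4 (I (Suc i)) s'" if "I i s'" "i < N" for i s'
    proof
      show "wp emit_body 4 (I (Suc i)) s'"
        unfolding emit_body_def
        by (intro wp_block_Seq wp_Cond wp_block)
          (use that in \<open>auto simp: I_def fun_eq_iff le_Suc_eq\<close>)
    qed (use that in \<open>simp add: I_def\<close>)
  qed (use assms in \<open>auto simp: I_def output_jury_def fun_eq_iff\<close>)
qed

lemma wp_select_jury:
  assumes "1 \<le> N" and \<epsilon>: "\<And>j. j \<in> {1..N} \<Longrightarrow> 0 < \<epsilon> j \<and> \<epsilon> j < 1"
  shows "wp select_jury (17 * N ^ 2 + 21 * N + 7)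
    (\<lambda>s. solves_JSP \<epsilon> (AltrM {1..N}) (output_jury N s)) (input_state N \<epsilon>)"
  unfolding select_jury_def
proof (rule wp_Seq)
  show "wp (Seq (block [RConst ''one'' 1, RConst ''bestv'' 2, RStore ''q'' ''zero'' ''one''])
      (While (NLess ''m'' ''N'') select_jury_body)) (17 * N ^ 2 + 16 * N + 4)
      (loop_inv N \<epsilon> N N) (input_state N \<epsilon>)"
  proof (rule wp_block_for[where I = "\<lambda>m. loop_inv N \<epsilon> m m" and n = N and t = "17 * N + 15"])
    show "loop_inv N \<epsilon> 0 0
        (fold step [RConst ''one'' 1, RConst ''bestv'' 2, RStore ''q'' ''zero'' ''one''] (input_state N \<epsilon>))"
      \<comment> \<open>Initially \<open>q\<close> reads 1, 0, 0, and so on, which are the tails of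
        the empty jury.\<close>
      using tail_empty_Suc by (auto simp: loop_inv_def input_state_def best_found_0 ranking_0 tail_0 gr0_conv_Suc)
    show "holds (NLess ''m'' ''N'') s \<and> wp select_jury_body (17 * N + 15) (loop_inv N \<epsilon> (Suc m) (Suc m)) s"
      if "loop_inv N \<epsilon> m m s" "m < N" for m s
    proof
      show "holds (NLess ''m'' ''N'') s" using that by (simp add: loop_inv_def)
      show "wp select_jury_body (17 * N + 15) (loop_inv N \<epsilon> (Suc m) (Suc m)) s"
        using that \<epsilon> by (rule wp_select_jury_body)
    qed
    show "\<not> holds (NLess ''m'' ''N'') s" if "loop_inv N \<epsilon> N N s" for s
      using that by (simp add: loop_inv_def)
  qed (simp_all add: power2_eq_square algebra_simps)
next
  fix s assume inv: "loop_inv N \<epsilon> N N s"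
  let ?r = "narr s ''rank''" and ?n = "nreg s ''bestm''"
  have r: "ranking N \<epsilon> ?r N" and best: "best_found N \<epsilon> ?r N ?n (rreg s ''bestv'')"
    using inv unfolding loop_inv_def by blast+
  \<comment> \<open>As \<open>N\<close> is positive, the default branch of \<open>best_found\<close>
    is excluded and a genuine odd prefix has been recorded.\<close>
  then have n: "odd ?n" "?n \<le> N" and v: "rreg s ''bestv'' = prefix_error N \<epsilon> ?r ?n"
    using \<open>1 \<le> N\<close> by (simp_all add: best_found_def)
  let ?J = "selected N ?r ?n"
  have card: "card ?J = ?n" using r n unfolding ranking_def by blast
  \<comment> \<open>At the end all jurors are ranked, so the bound \<open>?n\<close> on the rank
    alone cuts out the prefix.\<close>
  have "\<And>i. i \<in> {1..N} \<Longrightarrow> 1 \<le> ?r i"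
    using ranking_full[OF r] unfolding selected_def by blast
  then have "{i \<in> {1..N}. ?r i \<le> ?n} = ?J" unfolding selected_def by blast
  moreover have "solves_JSP \<epsilon> (AltrM {1..N}) ?J"
    unfolding solves_JSP_def
  proof (intro conjI ballI)
    show "?J \<in> AltrM {1..N}" using selected_subset card n by (simp add: AltrM_def jury_def)
    fix J' assume "J' \<in> AltrM {1..N}"
    then have J': "J' \<subseteq> {1..N}" "odd (card J')" by (simp_all add: AltrM_def jury_def)
    then have "finite J'" "card J' \<le> N" using finite_subset card_mono[OF _ J'(1)] by auto
    have "JER \<epsilon> ?J = rreg s ''bestv''" using v card by (simp add: JER_eq_tail prefix_error_def)
    also have "\<dots> \<le> prefix_error N \<epsilon> ?r (card J')"
      using best \<open>card J' \<le> N\<close> J'(2) unfolding best_found_def by blast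
    also have "\<dots> \<le> JER \<epsilon> J'"
      unfolding JER_eq_tail[OF \<open>finite J'\<close>] using r \<epsilon> J'(1) by (rule prefix_error_le)
    finally show "JER \<epsilon> ?J \<le> JER \<epsilon> J'" .
  qed
  ultimately show "wp emit (5 * N + 3) (\<lambda>s. solves_JSP \<epsilon> (AltrM {1..N}) (output_jury N s)) s"
    using inv by (intro wp_mono[OF wp_emit[of s N]]) (simp_all add: loop_inv_def)
qed simp

text \<open>From \<open>N = 3\<close> on the logarithm is at least 1, because e \<le> 3. The
  constant 45 is 17 + 21 + 7, since \<open>N\<close> and 1 are at most \<open>N ^ 2\<close>.\<close>

lemma quadratic_bigo: "(\<lambda>N. 17 * real N ^ 2 + 21 * real N + 7) \<in> O(\<lambda>N. real N ^ 2 * ln (real N))"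
proof (rule bigoI)
  show "\<forall>\<^sub>F N in sequentially.
      norm (17 * real N ^ 2 + 21 * real N + 7) \<le> 45 * norm (real N ^ 2 * ln (real N))"
    using eventually_ge_at_top[of 3]
  proof eventually_elim
    case (elim N)
    then have N: "real N \<ge> 3" by simp
    then have ln: "ln (real N) \<ge> 1" using exp_le by (subst ln_ge_iff) linarith+
    have "real N * 1 \<le> real N * real N" using N by (intro mult_left_mono) simp_all
    then have "17 * real N ^ 2 + 21 * real N + 7 \<le> 45 * real N ^ 2 * 1"
      using N unfolding power2_eq_square by linarith
    also have "\<dots> \<le> 45 * real N ^ 2 * ln (real N)" using ln by (intro mult_left_mono) simp_all
    finally show ?case using ln by (simp add: abs_mult)
  qed
qed

theorem mainTheorem5:
  "\<exists>(P :: com) (T :: nat \<Rightarrow> real).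
     T \<in> O(\<lambda>N. real N ^ 2 * ln (real N)) \<and>
     (\<forall>(N :: nat) (\<epsilon> :: nat \<Rightarrow> real).
        1 \<le> N \<longrightarrow> (\<forall>i\<in>{1..N}. 0 < \<epsilon> i \<and> \<epsilon> i < 1) \<longrightarrow>
        (\<exists>t s. run P (input_state N \<epsilon>) t s \<and> real t \<le> T N \<and>
               solves_JSP \<epsilon> (AltrM {1..N}) (output_jury N s)))"
proof (rule exI[of _ select_jury], rule exI[of _ "\<lambda>N. 17 * real N ^ 2 + 21 * real N + 7"],
    intro conjI allI impI quadratic_bigo)
  fix N :: nat and \<epsilon> :: "nat \<Rightarrow> real"
  assume "1 \<le> N" "\<forall>i\<in>{1..N}. 0 < \<epsilon> i \<and> \<epsilon> i < 1"
  then obtain t s where ts: "run select_jury (input_state N \<epsilon>) t s"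
    "t \<le> 17 * N ^ 2 + 21 * N + 7" "solves_JSP \<epsilon> (AltrM {1..N}) (output_jury N s)"
    using wp_select_jury[of N \<epsilon>] unfolding wp_def by blast
  have "real t \<le> real (17 * N ^ 2 + 21 * N + 7)" using ts(2) by (rule of_nat_mono)
  then have "real t \<le> 17 * real N ^ 2 + 21 * real N + 7" by simp
  with ts show "\<exists>t s. run select_jury (input_state N \<epsilon>) t s \<and>
      real t \<le> 17 * real N ^ 2 + 21 * real N + 7 \<and>
      solves_JSP \<epsilon> (AltrM {1..N}) (output_jury N s)"
    by blast
qed

end
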